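(* Let $\beta\in\mathbb{R}$, let $\psi\in\mathfrak{M}$, and suppose that the characteristics $\alpha(t)=\frac{\psi(t)}{t|\psi'(t)|}$ and $\lambda(t)=\frac{\psi(t)}{|\psi'(t)|}$ satisfy $\alpha(t)\downarrow 0$ and $\lambda(t)\uparrow\infty$ as $t\to\infty$. Then for all $n\in\mathbb{N}$ such that $\alpha(n)\le\frac14$ $$\mathcal{E}_{n}(C^{\psi}_{\beta,1})_{C}=\psi(n)\lambda(n)\left(\frac1\pi+\frac{\xi_1}{\lambda(n)}+\xi_2\,\alpha(n)\right),$$ where $-1\le\xi_1\le1+\frac1\pi$ and $-4\le\xi_2\le\frac43\left(1+\frac1\pi\right)$.
   Context: All functions in the approximation classes are real-valued and $2\pi$-periodic; $\mathbb{N}=\{1,2,\dots\}$. $L_1$ is the space of $2\pi$-periodic functions summable on $[0,2\pi)$ with norm $\|f\|_1=\int_0^{2\pi}|f(t)|\,dt$; $C$ is the space of continuous $2\pi$-periodic functions with norm $\|f\|_C=\max_t|f(t)|$. $\mathfrak{M}$ is the set of all positive continuous convex (downward) functions $\psi(t)$, $t\ge1$, with $\lim_{t\to\infty}\psi(t)=0$. For $\psi\in\mathfrak{M}$, $\psi'(t):=\psi'(t+0)$ denotes the right derivative. The notation $\alpha(t)\downarrow0$ (resp. $\lambda(t)\uparrow\infty$) means that $\alpha$ is monotonically non-increasing on $[1,\infty)$ with limit $0$ (resp. $\lambda$ is monotonically non-decreasing on $[1,\infty)$ with limit $\infty$). The sequence $\psi(k)$, $k=1,2,\dots$, is the restriction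 of $\psi(t)$ to the natural numbers. With $\Psi_\beta(t)=\sum_{k=1}^{\infty}\psi(k)\cos\left(kt-\frac{\beta\pi}{2}\right)$, $C^{\psi}_{\beta,1}$ is the set of $2\pi$-periodic functions $f$ which for all $x\in\mathbb{R}$ have the form $$f(x)=\frac{a_0}{2}+\frac1\pi\int_{-\pi}^{\pi}\Psi_\beta(x-t)\varphi(t)\,dt,\qquad a_0\in\mathbb{R},\ \varphi\in L_1,\ \|\varphi\|_1\le1,\ \int_{-\pi}^{\pi}\varphi(t)\,dt=0.$$ $S_{n-1}(f;\cdot)$ is the partial Fourier sum of $f$ of order $n-1$, and $\mathcal{E}_{n}(C^{\psi}_{\beta,1})_{C}=\sup_{f\in C^{\psi}_{\beta,1}}\|f(\cdot)-S_{n-1}(f;\cdot)\|_C$. *)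

theory Defs
  imports "HOL-Analysis.Analysis"
begin

definition periodic_2pi :: "(real \<Rightarrow> real) \<Rightarrow> bool" where
  "periodic_2pi f \<longleftrightarrow> (\<forall>x. f (x + 2 * pi) = f x)"

(* Functions on [1,\<infinity>) are total functions on real; their values below 1 are irrelevant. *)
definition class_M :: "(real \<Rightarrow> real) set" where
  "class_M = {\<psi>. (\<forall>t\<ge>1. \<psi> t > 0) \<and> continuous_on {1..} \<psi> \<and> convex_on {1..} \<psi> \<and>
                  (\<psi> \<longlongrightarrow> 0) at_top}"

definition right_deriv :: "(real \<Rightarrow> real) \<Rightarrow> real \<Rightarrow> real" where
  "right_deriv \<psi> t = (THE D. (\<psi> has_real_derivative D) (at_right t))"

definition char_alpha :: "(real \<Rightarrow> real) \<Rightarrow> real \<Rightarrow> real" where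
  "char_alpha \<psi> t = \<psi> t / (t * \<bar>right_deriv \<psi> t\<bar>)"

definition char_lambda :: "(real \<Rightarrow> real) \<Rightarrow> real \<Rightarrow> real" where
  "char_lambda \<psi> t = \<psi> t / \<bar>right_deriv \<psi> t\<bar>"

definition decreases_to_0 :: "(real \<Rightarrow> real) \<Rightarrow> bool" where
  "decreases_to_0 a \<longleftrightarrow> antimono_on {1..} a \<and> (a \<longlongrightarrow> 0) at_top"

definition increases_to_infinity :: "(real \<Rightarrow> real) \<Rightarrow> bool" where
  "increases_to_infinity a \<longleftrightarrow> mono_on {1..} a \<and> filterlim a at_top at_top"

definition kernel_Psi :: "(real \<Rightarrow> real) \<Rightarrow> real \<Rightarrow> real \<Rightarrow> real" where
  "kernel_Psi \<psi> \<beta> t = (\<Sum>j. \<psi> (real (Suc j)) * cos (real (Suc j) * t - \<beta> * pi / 2))"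

definition L1_per :: "(real \<Rightarrow> real) set" where
  "L1_per = {\<phi>. periodic_2pi \<phi> \<and> set_integrable lebesgue {0..<2 * pi} \<phi>}"

definition L1_norm :: "(real \<Rightarrow> real) \<Rightarrow> real" where
  "L1_norm \<phi> = (LINT t:{0..<2 * pi}|lebesgue. \<bar>\<phi> t\<bar>)"

definition class_C :: "(real \<Rightarrow> real) \<Rightarrow> real \<Rightarrow> (real \<Rightarrow> real) set" where
  "class_C \<psi> \<beta> = {f. periodic_2pi f \<and>
     (\<exists>a0 \<phi>. \<phi> \<in> L1_per \<and> L1_norm \<phi> \<le> 1 \<and> (LINT t:{-pi..pi}|lebesgue. \<phi> t) = 0 \<and>
        (\<forall>x. f x = a0 / 2 + 1 / pi * (LINT t:{-pi..pi}|lebesgue. kernel_Psi \<psi> \<beta> (x - t) * \<phi> t)))}"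

definition fourier_cos_coeff :: "(real \<Rightarrow> real) \<Rightarrow> nat \<Rightarrow> real" where
  "fourier_cos_coeff f k = 1 / pi * (LINT t:{-pi..pi}|lebesgue. f t * cos (real k * t))"

definition fourier_sin_coeff :: "(real \<Rightarrow> real) \<Rightarrow> nat \<Rightarrow> real" where
  "fourier_sin_coeff f k = 1 / pi * (LINT t:{-pi..pi}|lebesgue. f t * sin (real k * t))"

definition fourier_sum :: "nat \<Rightarrow> (real \<Rightarrow> real) \<Rightarrow> real \<Rightarrow> real" where
  "fourier_sum m f x = fourier_cos_coeff f 0 / 2 +
     (\<Sum>k=1..m. fourier_cos_coeff f k * cos (real k * x) + fourier_sin_coeff f k * sin (real k * x))"

(* The uniform norm and the supremum over the class are taken in the extended reals, so that
   an equation with a real right-hand side includes their finiteness.  The norm is written as a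
   supremum; for continuous periodic functions this is the maximum. *)
definition C_norm :: "(real \<Rightarrow> real) \<Rightarrow> ereal" where
  "C_norm f = (SUP t. ereal \<bar>f t\<bar>)"

(* Used for n \<ge> 1 only, so the natural-number subtraction is exact. *)
definition fourier_deviation :: "nat \<Rightarrow> (real \<Rightarrow> real) set \<Rightarrow> ereal" where
  "fourier_deviation n F = (SUP f\<in>F. C_norm (\<lambda>x. f x - fourier_sum (n - 1) f x))"

end

theory Submission
  imports Defs
begin

text \<open>
  Write \<open>S\<close> for the sum of \<open>\<psi>(k)\<close> over \<open>k \<ge> n\<close> and \<open>T\<close> for the sum of \<open>(k - n) \<psi>(k)\<close>.  The
  deviation is close to \<open>S/\<pi>\<close>, and \<open>S\<close> is close to \<open>\<psi>(n) \<lambda>(n)\<close>.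

  \<^emph>\<open>Reduction to sums.\<close>  For \<open>f\<close> in the class, \<open>f - S\<^sub>n\<^sub>-\<^sub>1 f\<close> is \<open>1/\<pi>\<close> times the sum over
  \<open>k \<ge> n\<close> of \<open>\<psi>(k)\<close> times the integral of \<open>cos (k (x - t) - \<beta>\<pi>/2) \<phi>(t)\<close>
  (lemma \<open>convolution_minus_fourier_sum\<close>).  As \<open>\<parallel>\<phi>\<parallel>\<^sub>1 \<le> 1\<close>, each integral is at most \<open>1\<close> in absolute
  value, so the deviation is at most \<open>S/\<pi>\<close>.  This is almost attained.  Let \<open>\<phi>\<close> be a narrow
  dipole: half a point mass at \<open>0\<close> minus half a point mass at \<open>\<pi>/n\<close>.  For a suitable \<open>x\<close> between
  these points the harmonic of order \<open>n\<close> takes values of modulus \<open>1\<close> and opposite sign there,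
  whatever \<open>\<beta>\<close> is, and the harmonics of order \<open>k > n\<close> lag behind by a phase of at most
  \<open>(k - n) \<pi>/n\<close>.  Hence the deviation is at least \<open>(S - \<psi>(n) - (\<pi>/n) T)/\<pi>\<close>, where \<open>\<psi>(n)\<close> pays
  for the width of the dipole (lemmas \<open>extremal_dipole\<close> and \<open>fourier_deviation_ge_coefficient_sum\<close>).

  \<^emph>\<open>Estimates of the sums.\<close>  By convexity the right derivative controls the consecutive differences
  of \<open>\<psi>\<close>.  Monotonicity of \<open>\<lambda>\<close> gives \<open>\<lambda>(n) (\<psi>(k) - \<psi>(k+1)) \<le> \<psi>(k)\<close>, and telescoping gives
  \<open>S \<ge> \<psi>(n) \<lambda>(n)\<close>.  Monotonicity of \<open>\<alpha>\<close> gives \<open>\<psi>(k+1) \<le> \<alpha>(n) (k+1) (\<psi>(k) - \<psi>(k+1))\<close>, and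
  summation by parts gives, for \<open>\<alpha>(n) \<le> 1/4\<close>, an upper bound for \<open>S\<close> with leading term
  \<open>\<psi>(n) \<lambda>(n) / (1 - \<alpha>(n)) \<le> \<psi>(n) \<lambda>(n) (1 + 4/3 \<alpha>(n))\<close>, and the bound \<open>T \<le> 2 \<alpha>(n) (n + 1) S \<le> 4 \<alpha>(n) n S\<close>.  The constant
  \<open>4\<close> in the theorem is the latter one
  (lemmas \<open>class_M_decay_at_integers\<close> and \<open>summable_moments_of_fast_decay\<close>).
\<close>

section \<open>Decay of convex functions with monotone characteristics\<close>

text \<open>
  The difference quotients of a convex function at an interior point increase with the second
  endpoint, so those on the right of \<open>t\<close> decrease to their infimum, which is therefore the right
  derivative and dominates every quotient on the left.  In particular the definite description
  in \<^const>\<open>right_deriv\<close> denotes; at the endpoint \<open>t = a\<close> it need not, since the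
  quotients may tend to \<open>-\<infinity>\<close>.
\<close>
lemma convex_right_deriv_supporting_line:
  fixes \<psi> :: "real \<Rightarrow> real"
  assumes conv: "convex_on {a..} \<psi>" and "a < t" "a \<le> s"
  shows "\<psi> t + right_deriv \<psi> t * (s - t) \<le> \<psi> s"
proof -
  define q where "q = (\<lambda>s. (\<psi> s - \<psi> t) / (s - t))"
  have left_le_right: "q r \<le> q y" if "a \<le> r" "r < t" "t < y" for r y
    using convex_on_slope_le[OF conv, of r y t] that
    unfolding q_def by (smt (verit) atLeast_iff minus_divide_divide minus_diff_eq)
  have q_mono: "q x \<le> q y" if "t < x" "x < y" for x y
    using convex_on_slope_le(1)[OF conv, of t y x] that \<open>a < t\<close>
    unfolding q_def by (smt (verit) atLeast_iff minus_divide_divide minus_diff_eq)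
  define D where "D = Inf (q ` {t<..})"
  have bdd: "bdd_below (q ` {t<..})"
    using left_le_right[of a] \<open>a < t\<close> by (intro bdd_belowI[of _ "q a"]) auto
  have D_le: "D \<le> q y" if "t < y" for y
    unfolding D_def using bdd that by (intro cInf_lower) auto
  have le_D: "q r \<le> D" if "a \<le> r" "r < t" for r
    unfolding D_def using left_le_right that by (intro cInf_greatest) auto
  have lim: "(q \<longlongrightarrow> D) (at_right t)"
  proof (rule decreasing_tendsto)
    show "\<forall>\<^sub>F y in at_right t. D \<le> q y"
      using D_le by (auto simp: eventually_at_filter)
    fix z assume "D < z"
    then obtain y where y: "t < y" "q y < z"
      using cInf_lessD[of "q ` {t<..}" z] unfolding D_def by auto
    show "\<forall>\<^sub>F x in at_right t. q x < z"
      using q_mono y by (auto simp: eventually_at_right_field intro!: exI[of _ y] intro: le_less_trans)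
  qed
  have "right_deriv \<psi> t = D"
    using lim tendsto_unique[OF trivial_limit_at_right_real _ lim]
    unfolding right_deriv_def has_field_derivative_iff q_def by (intro the_equality)
  moreover consider "s < t" | "s = t" | "t < s" by linarith
  then have "\<psi> t + D * (s - t) \<le> \<psi> s"
  proof cases
    case 1
    then have "q s * (s - t) = \<psi> s - \<psi> t" "q s \<le> D"
      using le_D \<open>a \<le> s\<close> by (auto simp: q_def)
    with mult_right_mono_neg[of "q s" D "s - t"] 1 show ?thesis by simp
  next
    case 3
    then have "q s * (s - t) = \<psi> s - \<psi> t" "D \<le> q s"
      using D_le by (auto simp: q_def)
    with mult_right_mono[of D "q s" "s - t"] 3 show ?thesis by simp
  qed simp
  ultimately show ?thesis by simp
qed

text \<open>
  A discrete counterpart of integrating \<open>\<psi>(t) = t \<alpha>(t) |\<psi>'(t)|\<close> by parts.  Summation by parts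
  of the decay hypothesis, taken with weight \<open>1\<close> or \<open>j\<close>, reproduces on the right-hand side a
  multiple \<open>a\<close> or \<open>2 a\<close> of the sum that is being estimated; since \<open>a \<le> 1/4\<close>, it can be moved to
  the left.  The boundary terms have a favourable sign, so convergence comes out together with
  the bounds.
\<close>
lemma summable_moments_of_fast_decay:
  fixes u :: "nat \<Rightarrow> real" and a s :: real
  assumes nonneg: "\<And>j. 0 \<le> u j" and a: "0 \<le> a" "a \<le> 1/4" and "0 \<le> s"
    and decay: "\<And>j. u (Suc j) \<le> a * (s + real j + 1) * (u j - u (Suc j))"
  shows "summable u"
    and "suminf u \<le> u 0 + (a * s + a) / (1 - a) * u 0"
    and "summable (\<lambda>j. real j * u j)"
    and "(\<Sum>j. real j * u j) \<le> 2 * a * (s + 1) * suminf u"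
proof -
  have sum0: "(\<Sum>j<N. u (Suc j)) \<le> a * ((s + 1) * u 0 + (\<Sum>j<N. u (Suc j)) - (s + real N + 1) * u N)" for N
  proof (induction N)
    case (Suc N)
    then show ?case using decay[of N] by (simp add: algebra_simps)
  qed simp
  have bound0: "(\<Sum>j<N. u (Suc j)) \<le> (a * s + a) / (1 - a) * u 0" for N
  proof -
    have "(1 - a) * (\<Sum>j<N. u (Suc j)) \<le> a * (s + 1) * u 0 - a * ((s + real N + 1) * u N)"
      using sum0[of N] by (simp add: algebra_simps)
    also have "\<dots> \<le> a * (s + 1) * u 0"
      using nonneg[of N] a \<open>0 \<le> s\<close> by simp
    finally show ?thesis using a by (simp add: field_simps)
  qed
  have tail: "summable (\<lambda>j. u (Suc j))"
    using bound0 nonneg by (intro summableI_nonneg_bounded) auto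
  then show u: "summable u" by (simp add: summable_Suc_iff)
  have "suminf u = u 0 + (\<Sum>j. u (Suc j))"
    using suminf_split_head[OF u] by simp
  with suminf_le_const[OF tail bound0]
  show "suminf u \<le> u 0 + (a * s + a) / (1 - a) * u 0" by simp
  have sum1: "(\<Sum>j\<le>N. real j * u j) \<le> a * ((\<Sum>j\<le>N. u j * (2 * real j + s + 1)) - ((s + real N) * real N + 2 * real N + s + 1) * u N)" for N
  proof (induction N)
    case (Suc N)
    have "real (Suc N) * u (Suc N) \<le> real (Suc N) * (a * (s + real N + 1) * (u N - u (Suc N)))"
      using decay[of N] by (intro mult_left_mono) auto
    with Suc show ?case by (simp add: algebra_simps)
  qed simp
  have bound1: "(\<Sum>j\<le>N. real j * u j) \<le> 2 * a * (s + 1) * suminf u" for N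
  proof -
    let ?T = "\<Sum>j\<le>N. real j * u j" and ?S = "\<Sum>j\<le>N. u j"
    have T: "0 \<le> ?T" and "0 \<le> ?S" using nonneg by (auto intro!: sum_nonneg)
    have split: "(\<Sum>j\<le>N. u j * (2 * real j + s + 1)) = 2 * ?T + (s + 1) * ?S"
      by (simp add: sum_distrib_left algebra_simps sum.distrib)
    have "0 \<le> a * (((s + real N) * real N + 2 * real N + s + 1) * u N)"
      using a nonneg[of N] \<open>0 \<le> s\<close> by simp
    with sum1[of N] have "?T \<le> a * (2 * ?T + (s + 1) * ?S)"
      by (simp add: split right_diff_distrib)
    moreover have "a * (2 * ?T) \<le> 1/4 * (2 * ?T)"
      using a T by (intro mult_right_mono) auto
    ultimately have "?T \<le> 2 * a * (s + 1) * ?S" by (simp add: algebra_simps)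
    also have "\<dots> \<le> 2 * a * (s + 1) * suminf u"
      using a \<open>0 \<le> s\<close> nonneg by (intro mult_left_mono sum_le_suminf u) auto
    finally show ?thesis .
  qed
  have bound1': "(\<Sum>j<N. real j * u j) \<le> 2 * a * (s + 1) * suminf u" for N
    using nonneg by (intro order_trans[OF sum_mono2 bound1[of N]]) auto
  then show "summable (\<lambda>j. real j * u j)"
    using nonneg by (intro summableI_nonneg_bounded) auto
  then show "(\<Sum>j. real j * u j) \<le> 2 * a * (s + 1) * suminf u"
    by (rule suminf_le_const) (rule bound1')
qed

lemma suminf_ge_of_slow_decay:
  fixes u :: "nat \<Rightarrow> real" and l :: real
  assumes "summable u" and decay: "\<And>j. l * (u j - u (Suc j)) \<le> u j"
  shows "l * u 0 \<le> suminf u"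
proof -
  have "(\<lambda>j. u j - u (Suc j)) sums (u 0 - 0)"
    by (rule telescope_sums'[OF summable_LIMSEQ_zero[OF assms(1)]])
  then have "(\<lambda>j. l * (u j - u (Suc j))) sums (l * u 0)"
    using sums_mult by fastforce
  from sums_le[OF decay this summable_sums[OF assms(1)]] show ?thesis .
qed

lemma class_M_right_deriv_neg:
  assumes "\<psi> \<in> class_M" "1 < t"
  shows "right_deriv \<psi> t < 0"
proof -
  have "(\<psi> \<longlongrightarrow> 0) at_top" "0 < \<psi> t" using assms by (auto simp: class_M_def)
  then have "\<forall>\<^sub>F s in at_top. \<psi> s < \<psi> t" by (auto simp: order_tendsto_iff)
  then obtain s where s: "t < s" "\<psi> s < \<psi> t"
    using eventually_happens[OF eventually_conj[OF _ eventually_gt_at_top[of t]]] by force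
  have "\<psi> t + right_deriv \<psi> t * (s - t) \<le> \<psi> s"
    using assms s by (intro convex_right_deriv_supporting_line[of 1]) (auto simp: class_M_def)
  with s have "right_deriv \<psi> t * (s - t) < 0" by simp
  with s show ?thesis by (simp add: mult_less_0_iff)
qed

text \<open>
  The monotone characteristics enter the proof only through these two inequalities between
  consecutive values of \<open>\<psi>\<close>.  The first uses the supporting line at the right endpoint \<open>k + 1\<close>,
  the second the one at the left endpoint \<open>k\<close>.
\<close>
lemma class_M_decay_at_integers:
  fixes \<psi> :: "real \<Rightarrow> real" and n :: nat
  assumes M: "\<psi> \<in> class_M" and al: "antimono_on {1..} (char_alpha \<psi>)"
    and la: "mono_on {1..} (char_lambda \<psi>)" and n: "n \<ge> 1"
  shows "0 < char_alpha \<psi> (real n)"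
    and "char_lambda \<psi> (real n) = real n * char_alpha \<psi> (real n)"
    and "\<psi> (real (n + Suc j))
           \<le> char_alpha \<psi> (real n) * (real n + real j + 1) * (\<psi> (real (n + j)) - \<psi> (real (n + Suc j)))"
    and "char_lambda \<psi> (real n) * (\<psi> (real (n + j)) - \<psi> (real (n + Suc j))) \<le> \<psi> (real (n + j))"
proof -
  let ?a = "char_alpha \<psi>" and ?l = "char_lambda \<psi>" and ?D = "right_deriv \<psi>"
  have pos: "0 < \<psi> t" if "t \<ge> 1" for t using M that by (simp add: class_M_def)
  have line: "\<psi> t + ?D t * (s - t) \<le> \<psi> s" if "1 < t" "1 \<le> s" for s t
    using M that by (intro convex_right_deriv_supporting_line[of 1]) (auto simp: class_M_def)
  have neg: "?D t < 0" if "1 < t" for t using class_M_right_deriv_neg[OF M that] .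
  show l_eq: "?l (real n) = real n * ?a (real n)"
    using n by (simp add: char_lambda_def char_alpha_def)
  \<comment> \<open>Positivity is read off one step to the right, because for \<open>n = 1\<close> the right derivative
      in the denominator may not exist, and then its value is arbitrary.\<close>
  have "0 < ?a (real n + 1)"
    using pos[of "real n + 1"] neg[of "real n + 1"] n
    unfolding char_alpha_def by (intro divide_pos_pos mult_pos_pos) auto
  also have "\<dots> \<le> ?a (real n)"
    using n by (intro monotone_onD[OF al]) auto
  finally show a_pos: "0 < ?a (real n)" .
  then have l_pos: "0 < ?l (real n)" using n l_eq by simp
  let ?k = "real (n + j)"
  have k1: "real (n + Suc j) = ?k + 1" by simp
  have k: "1 \<le> ?k" "real n \<le> ?k" using n by auto
  show "\<psi> (real (n + Suc j)) \<le> ?a (real n) * (real n + real j + 1) * (\<psi> ?k - \<psi> (real (n + Suc j)))"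
  proof -
    have D: "?D (?k + 1) < 0" using neg k by simp
    have "?a (?k + 1) \<le> ?a (real n)"
      using k n by (intro monotone_onD[OF al]) auto
    then have "\<psi> (?k + 1) \<le> ?a (real n) * ((?k + 1) * \<bar>?D (?k + 1)\<bar>)"
      using k D unfolding char_alpha_def
      by (subst (asm) pos_divide_le_eq) (auto intro!: mult_pos_neg)
    then have "\<psi> (?k + 1) \<le> ?a (real n) * (?k + 1) * (- ?D (?k + 1))"
      using D by (simp add: mult.assoc)
    also have "\<dots> \<le> ?a (real n) * (?k + 1) * (\<psi> ?k - \<psi> (?k + 1))"
      using line[of "?k + 1" ?k] k a_pos by (intro mult_left_mono) auto
    finally show ?thesis by (simp add: add_ac)
  qed
  \<comment> \<open>For \<open>k = 1\<close> the right derivative at \<open>k\<close> may not exist, so the supporting line is taken at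
      points \<open>t > k\<close> and \<open>t\<close> tends to \<open>k\<close> afterwards.\<close>
  have near: "?l (real n) * (\<psi> t - \<psi> (?k + 1)) \<le> (?k + 1 - t) * \<psi> t" if t: "?k < t" "t < ?k + 1" for t
  proof -
    have D: "?D t < 0" using neg k t by simp
    have "?l (real n) \<le> ?l t"
      using k n t by (intro monotone_onD[OF la]) auto
    then have "?l (real n) * \<bar>?D t\<bar> \<le> \<psi> t"
      using D unfolding char_lambda_def[of _ t] by (subst (asm) pos_le_divide_eq) auto
    then have "?l (real n) * (- ?D t) \<le> \<psi> t" using D by simp
    then have *: "(?k + 1 - t) * (?l (real n) * (- ?D t)) \<le> (?k + 1 - t) * \<psi> t"
      using t by (intro mult_left_mono) auto
    have "?l (real n) * (\<psi> t - \<psi> (?k + 1)) \<le> ?l (real n) * (- ?D t * (?k + 1 - t))"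
      using line[of t "?k + 1"] k t l_pos by (intro mult_left_mono) auto
    with * show ?thesis by (simp add: algebra_simps)
  qed
  have "continuous_on {1..} \<psi>" using M by (simp add: class_M_def)
  then have "(\<psi> \<longlongrightarrow> \<psi> ?k) (at ?k within {1..})"
    using k by (simp add: continuous_on)
  then have lim: "(\<psi> \<longlongrightarrow> \<psi> ?k) (at_right ?k)"
    by (rule tendsto_mono[rotated]) (use k in \<open>auto intro!: at_le\<close>)
  have "?l (real n) * (\<psi> ?k - \<psi> (?k + 1)) \<le> (?k + 1 - ?k) * \<psi> ?k"
  proof (rule tendsto_le[OF trivial_limit_at_right_real])
    show "((\<lambda>t. (?k + 1 - t) * \<psi> t) \<longlongrightarrow> (?k + 1 - ?k) * \<psi> ?k) (at_right ?k)"
      and "((\<lambda>t. ?l (real n) * (\<psi> t - \<psi> (?k + 1))) \<longlongrightarrow> ?l (real n) * (\<psi> ?k - \<psi> (?k + 1))) (at_right ?k)"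
      by (rule tendsto_intros lim)+
    show "\<forall>\<^sub>F t in at_right ?k. ?l (real n) * (\<psi> t - \<psi> (?k + 1)) \<le> (?k + 1 - t) * \<psi> t"
      using near unfolding eventually_at_right_field by (intro exI[of _ "?k + 1"]) auto
  qed
  then show "?l (real n) * (\<psi> ?k - \<psi> (real (n + Suc j))) \<le> \<psi> ?k" by (simp add: add_ac)
qed

section \<open>Fourier sums of absolutely convergent trigonometric series\<close>

lemma set_integrable_bounded_mult:
  fixes h g :: "'a \<Rightarrow> real"
  assumes g: "set_integrable M S g" and meas: "h \<in> borel_measurable M" and bound: "\<And>t. \<bar>h t\<bar> \<le> 1"
  shows "set_integrable M S (\<lambda>t. h t * g t)"
proof -
  let ?g = "\<lambda>t. indicator S t * g t"
  have gi: "integrable M ?g" using g by (simp add: set_integrable_def)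
  have "integrable M (\<lambda>t. h t * ?g t)"
  proof (rule Bochner_Integration.integrable_bound[OF gi])
    show "(\<lambda>t. h t * ?g t) \<in> borel_measurable M"
      using meas borel_measurable_integrable[OF gi] by simp
    have "\<bar>h t\<bar> * \<bar>?g t\<bar> \<le> 1 * \<bar>?g t\<bar>" for t
      by (intro mult_right_mono bound) simp
    then show "AE t in M. norm (h t * ?g t) \<le> norm (?g t)" by (simp add: abs_mult)
  qed
  then show ?thesis by (simp add: set_integrable_def mult.left_commute)
qed

lemma set_integral_suminf_bounded:
  fixes h :: "nat \<Rightarrow> real \<Rightarrow> real" and g :: "real \<Rightarrow> real"
  assumes g: "set_integrable M S g" and c: "summable (\<lambda>j. \<bar>c j\<bar>)"
    and meas: "\<And>j. h j \<in> borel_measurable M" and bound: "\<And>j t. \<bar>h j t\<bar> \<le> 1"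
  shows "set_integrable M S (\<lambda>t. (\<Sum>j. c j * h j t) * g t)"
    and "(\<lambda>j. c j * (LINT t:S|M. h j t * g t)) sums (LINT t:S|M. (\<Sum>j. c j * h j t) * g t)"
proof -
  let ?g = "\<lambda>t. indicator S t * g t"
  let ?F = "\<lambda>j t. c j * h j t * ?g t"
  have gi: "integrable M ?g" using g by (simp add: set_integrable_def)
  have hi: "integrable M (\<lambda>t. h j t * ?g t)" for j
    using set_integrable_bounded_mult[OF g meas bound, of j]
    by (simp add: set_integrable_def mult.left_commute)
  have Fi: "integrable M (?F j)" for j
    using integrable_mult_right[OF hi[of j], of "c j"] by (simp add: mult.assoc)
  have le: "\<bar>c j * h j t\<bar> \<le> \<bar>c j\<bar>" for j t
    using mult_left_mono[OF bound[of j t], of "\<bar>c j\<bar>"] by (simp add: abs_mult)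
  have sum_ch: "summable (\<lambda>j. \<bar>c j * h j t\<bar>)" for t
    by (rule summable_comparison_test'[OF c, of 0]) (simp add: le)
  have sum_F: "summable (\<lambda>j. norm (?F j t))" for t
    using summable_mult2[OF sum_ch[of t], of "\<bar>?g t\<bar>"] by (simp add: abs_mult)
  have sum_int: "summable (\<lambda>j. \<integral>t. norm (?F j t) \<partial>M)"
  proof (rule summable_comparison_test'[of "\<lambda>j. \<bar>c j\<bar> * (\<integral>t. \<bar>?g t\<bar> \<partial>M)" 0])
    show "summable (\<lambda>j. \<bar>c j\<bar> * (\<integral>t. \<bar>?g t\<bar> \<partial>M))"
      by (rule summable_mult2[OF c])
    fix j :: nat
    have "(\<integral>t. norm (?F j t) \<partial>M) \<le> (\<integral>t. \<bar>c j\<bar> * \<bar>?g t\<bar> \<partial>M)"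
    proof (rule integral_mono)
      show "norm (?F j t) \<le> \<bar>c j\<bar> * \<bar>?g t\<bar>" for t
        using mult_right_mono[OF le[of j t], of "\<bar>?g t\<bar>"] by (simp add: abs_mult)
    qed (use Fi gi in auto)
    then show "norm (\<integral>t. norm (?F j t) \<partial>M) \<le> \<bar>c j\<bar> * (\<integral>t. \<bar>?g t\<bar> \<partial>M)"
      by simp
  qed
  have eq: "(\<Sum>j. ?F j t) = indicator S t *\<^sub>R ((\<Sum>j. c j * h j t) * g t)" for t
    using suminf_mult2[OF summable_rabs_cancel[OF sum_ch[of t]], of "?g t"] by (simp add: mult_ac)
  show "set_integrable M S (\<lambda>t. (\<Sum>j. c j * h j t) * g t)"
    using integrable_suminf[OF Fi AE_I2[OF sum_F] sum_int] unfolding eq set_integrable_def .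
  have eqj: "(\<integral>t. ?F j t \<partial>M) = c j * (LINT t:S|M. h j t * g t)" for j
    by (simp add: set_lebesgue_integral_def mult.assoc mult.left_commute)
  show "(\<lambda>j. c j * (LINT t:S|M. h j t * g t)) sums (LINT t:S|M. (\<Sum>j. c j * h j t) * g t)"
    using sums_integral[OF Fi AE_I2[OF sum_F] sum_int] unfolding eqj eq set_lebesgue_integral_def .
qed

lemma set_integrable_continuous:
  fixes f :: "real \<Rightarrow> real"
  shows "continuous_on {a..b} f \<Longrightarrow> set_integrable lebesgue {a..b} f"
  by (rule absolutely_integrable_continuous_real)

lemma continuous_borel_measurable_lebesgue:
  fixes f :: "real \<Rightarrow> real"
  assumes "continuous_on UNIV f"
  shows "f \<in> borel_measurable lebesgue"
  using borel_measurable_continuous_onI[OF assms] by (intro measurable_completion) simp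

lemma set_integral_cos_int:
  "(LINT t:{-pi..pi}|lebesgue. cos (real_of_int n * t)) = (if n = 0 then 2 * pi else 0)"
  by (subst set_lebesgue_integral_eq_integral(2))
    (auto intro!: set_integrable_continuous continuous_intros has_integral_cos_nx[THEN integral_unique, THEN trans])

lemma set_integral_sin_int:
  "(LINT t:{-pi..pi}|lebesgue. sin (real_of_int n * t)) = 0"
  by (subst set_lebesgue_integral_eq_integral(2))
    (auto intro!: set_integrable_continuous continuous_intros has_integral_sin_nx[THEN integral_unique])

lemma trig_orthogonality:
  fixes k m :: nat
  shows "(LINT t:{-pi..pi}|lebesgue. cos (real k * t) * cos (real m * t)) = (if k = m then (if k = 0 then 2 * pi else pi) else 0)"
    and "(LINT t:{-pi..pi}|lebesgue. sin (real k * t) * sin (real m * t)) = (if k = m \<and> k \<noteq> 0 then pi else 0)"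
    and "(LINT t:{-pi..pi}|lebesgue. sin (real k * t) * cos (real m * t)) = 0"
proof -
  let ?d = "int k - int m" and ?s = "int k + int m"
  have int: "set_integrable lebesgue {-pi..pi} (\<lambda>t. cos (real_of_int j * t))"
     "set_integrable lebesgue {-pi..pi} (\<lambda>t. sin (real_of_int j * t))" for j
    by (auto intro!: set_integrable_continuous continuous_intros)
  have "cos (real k * t) * cos (real m * t) = (cos (real_of_int ?d * t) + cos (real_of_int ?s * t)) / 2" for t
    by (simp add: cos_times_cos algebra_simps)
  then show "(LINT t:{-pi..pi}|lebesgue. cos (real k * t) * cos (real m * t)) = (if k = m then (if k = 0 then 2 * pi else pi) else 0)"
    by (simp only: set_integral_divide_zero set_integral_add(2)[OF int(1) int(1)] set_integral_cos_int) auto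
  have "sin (real k * t) * sin (real m * t) = (cos (real_of_int ?d * t) - cos (real_of_int ?s * t)) / 2" for t
    by (simp add: sin_times_sin algebra_simps)
  then show "(LINT t:{-pi..pi}|lebesgue. sin (real k * t) * sin (real m * t)) = (if k = m \<and> k \<noteq> 0 then pi else 0)"
    by (simp only: set_integral_divide_zero set_integral_diff(2)[OF int(1) int(1)] set_integral_cos_int) auto
  have "sin (real k * t) * cos (real m * t) = (sin (real_of_int ?s * t) + sin (real_of_int ?d * t)) / 2" for t
    by (simp add: sin_times_cos left_diff_distrib distrib_right)
  then show "(LINT t:{-pi..pi}|lebesgue. sin (real k * t) * cos (real m * t)) = 0"
    by (simp only: set_integral_divide_zero set_integral_add(2)[OF int(2) int(2)] set_integral_sin_int) simp
qed

text \<open>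
  Absolute convergence of the coefficients allows termwise integration against each cosine and
  sine, so orthogonality identifies the given series with the Fourier series.
\<close>
lemma trig_series_minus_fourier_sum:
  fixes p q :: "nat \<Rightarrow> real"
  assumes p: "summable (\<lambda>j. \<bar>p j\<bar>)" and q: "summable (\<lambda>j. \<bar>q j\<bar>)"
    and f: "\<And>x. f x = c / 2 + (\<Sum>j. p j * cos (real (Suc j) * x) + q j * sin (real (Suc j) * x))"
  shows "(\<lambda>j. p (j + m) * cos (real (Suc (j + m)) * x) + q (j + m) * sin (real (Suc (j + m)) * x))
           sums (f x - fourier_sum m f x)"
proof -
  let ?C = "\<lambda>j t. cos (real (Suc j) * t)" and ?S = "\<lambda>j t. sin (real (Suc j) * t)"
  have sp: "summable (\<lambda>j. p j * ?C j x)" for x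
  proof (rule summable_comparison_test'[OF p, of 0])
    show "norm (p j * ?C j x) \<le> \<bar>p j\<bar>" for j
      using mult_left_mono[OF abs_cos_le_one, of "\<bar>p j\<bar>"] by (simp add: abs_mult)
  qed
  have sq: "summable (\<lambda>j. q j * ?S j x)" for x
  proof (rule summable_comparison_test'[OF q, of 0])
    show "norm (q j * ?S j x) \<le> \<bar>q j\<bar>" for j
      using mult_left_mono[OF abs_sin_le_one, of "\<bar>q j\<bar>"] by (simp add: abs_mult)
  qed
  have f': "f x = c / 2 + (\<Sum>j. p j * ?C j x) + (\<Sum>j. q j * ?S j x)" for x
    using f suminf_add[OF sp sq] by simp
  have coeff: "(\<lambda>j. p j * (LINT t:{-pi..pi}|lebesgue. ?C j t * g t) + q j * (LINT t:{-pi..pi}|lebesgue. ?S j t * g t))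
      sums ((LINT t:{-pi..pi}|lebesgue. f t * g t) - c / 2 * (LINT t:{-pi..pi}|lebesgue. g t))"
    if "continuous_on {-pi..pi} g" for g
  proof -
    have gi: "set_integrable lebesgue {-pi..pi} g" using that by (rule set_integrable_continuous)
    note P = set_integral_suminf_bounded[OF gi p, of ?C]
    note Q = set_integral_suminf_bounded[OF gi q, of ?S]
    have mC: "?C j \<in> borel_measurable lebesgue" and mS: "?S j \<in> borel_measurable lebesgue" for j
      by (intro continuous_borel_measurable_lebesgue continuous_intros)+
    note Pi = P(1)[OF mC abs_cos_le_one] and Qi = Q(1)[OF mS abs_sin_le_one]
    have "(LINT t:{-pi..pi}|lebesgue. f t * g t) = (LINT t:{-pi..pi}|lebesgue. c / 2 * g t +
            ((\<Sum>j. p j * ?C j t) * g t + (\<Sum>j. q j * ?S j t) * g t))"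
      by (simp only: f' distrib_right add.assoc)
    also have "\<dots> = c / 2 * (LINT t:{-pi..pi}|lebesgue. g t) + ((LINT t:{-pi..pi}|lebesgue. (\<Sum>j. p j * ?C j t) * g t)
         + (LINT t:{-pi..pi}|lebesgue. (\<Sum>j. q j * ?S j t) * g t))"
      using set_integral_add(2)[OF set_integrable_mult_right[OF gi, of "c / 2"] set_integral_add(1)[OF Pi Qi]]
        set_integral_add(2)[OF Pi Qi] by simp
    finally show ?thesis
      using sums_add[OF P(2) Q(2)] mC mS by simp
  qed
  have cont_cos: "continuous_on {-pi..pi} (\<lambda>t. cos (real k * t))"
   and cont_sin: "continuous_on {-pi..pi} (\<lambda>t. sin (real k * t))" for k
    by (intro continuous_intros)+
  have a0: "fourier_cos_coeff f 0 = c"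
    using coeff[OF cont_cos[of 0]] set_integral_cos_int[of 0] unfolding trig_orthogonality
    by (auto simp: fourier_cos_coeff_def dest!: sums_unique)
  have delta: "(\<lambda>j. r j * (if Suc j = Suc i then pi else 0) + w j * 0) sums (r i * pi)" for r w :: "nat \<Rightarrow> real" and i
  proof -
    have "(\<lambda>j. r j * (if Suc j = Suc i then pi else 0) + w j * 0) = (\<lambda>j. if j = i then r j * pi else 0)"
      by auto
    then show ?thesis using sums_single[of i "\<lambda>j. r j * pi"] by simp
  qed
  have ai: "fourier_cos_coeff f (Suc i) = p i" for i
  proof -
    have "(LINT t:{-pi..pi}|lebesgue. cos (real (Suc i) * t)) = 0"
      using set_integral_cos_int[of "int (Suc i)"] by simp
    moreover have "(\<lambda>j. p j * (if Suc j = Suc i then pi else 0) + q j * 0)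
        sums ((LINT t:{-pi..pi}|lebesgue. f t * cos (real (Suc i) * t)) - c / 2 * (LINT t:{-pi..pi}|lebesgue. cos (real (Suc i) * t)))"
      using coeff[OF cont_cos[of "Suc i"]] unfolding trig_orthogonality
      by (simp cong: if_cong)
    ultimately have "p i * pi = (LINT t:{-pi..pi}|lebesgue. f t * cos (real (Suc i) * t))"
      using sums_unique2[OF delta[of p i q]] by fastforce
    then show ?thesis by (simp add: fourier_cos_coeff_def divide_eq_eq flip: of_nat_Suc)
  qed
  have bi: "fourier_sin_coeff f (Suc i) = q i" for i
  proof -
    have "(LINT t:{-pi..pi}|lebesgue. sin (real (Suc i) * t)) = 0"
      using set_integral_sin_int[of "int (Suc i)"] by simp
    moreover have "(LINT t:{-pi..pi}|lebesgue. cos (real (Suc j) * t) * sin (real (Suc i) * t)) = 0" for j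
      using trig_orthogonality(3)[of "Suc i" "Suc j"] by (simp add: mult.commute)
    then have "(\<lambda>j. q j * (if Suc j = Suc i then pi else 0) + p j * 0)
        sums ((LINT t:{-pi..pi}|lebesgue. f t * sin (real (Suc i) * t)) - c / 2 * (LINT t:{-pi..pi}|lebesgue. sin (real (Suc i) * t)))"
      using coeff[OF cont_sin[of "Suc i"]] unfolding trig_orthogonality
      by (simp add: add.commute cong: if_cong)
    ultimately have "q i * pi = (LINT t:{-pi..pi}|lebesgue. f t * sin (real (Suc i) * t))"
      using sums_unique2[OF delta[of q i p]] by fastforce
    then show ?thesis by (simp add: fourier_sin_coeff_def divide_eq_eq flip: of_nat_Suc)
  qed
  have "fourier_sum m f x = c / 2 + (\<Sum>j<m. p j * ?C j x + q j * ?S j x)"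
  proof -
    have "(\<Sum>k=1..m. fourier_cos_coeff f k * cos (real k * x) + fourier_sin_coeff f k * sin (real k * x))
        = (\<Sum>j<m. p j * ?C j x + q j * ?S j x)"
      by (rule sum.reindex_bij_witness[of _ Suc "\<lambda>k. k - 1"]) (auto simp flip: ai bi)
    then show ?thesis by (simp add: fourier_sum_def a0)
  qed
  then have "f x - fourier_sum m f x = (\<Sum>j. p j * ?C j x + q j * ?S j x) - (\<Sum>j<m. p j * ?C j x + q j * ?S j x)"
    by (simp add: f)
  with sums_split_initial_segment[OF summable_sums[OF summable_add[OF sp sq]], of m x x]
  show ?thesis by simp
qed

section \<open>The remainder of a convolution with the kernel\<close>

lemma periodic_set_integral_shift:
  fixes g :: "real \<Rightarrow> real"
  assumes per: "periodic_2pi g" and int: "set_integrable lebesgue {0..<2 * pi} g"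
  shows "set_integrable lebesgue {-pi..pi} g"
    and "(LINT t:{-pi..pi}|lebesgue. g t) = (LINT t:{0..<2 * pi}|lebesgue. g t)"
proof -
  have sub: "set_integrable lebesgue {0..<pi} g" "set_integrable lebesgue {pi..<2 * pi} g"
    by (rule set_integrable_subset[OF int]; auto)+
  have shift: "indicator {pi..<2 * pi} (2 * pi + 1 * t) *\<^sub>R g (2 * pi + 1 * t) = indicator {-pi..<0} t *\<^sub>R g t" for t
    using per by (auto simp: periodic_2pi_def indicator_def add.commute)
  have left: "set_integrable lebesgue {-pi..<0} g"
    using lebesgue_integrable_real_affine[OF sub(2)[unfolded set_integrable_def], of 1 "2 * pi"]
    unfolding shift set_integrable_def by simp
  have left_eq: "(LINT t:{-pi..<0}|lebesgue. g t) = (LINT t:{pi..<2 * pi}|lebesgue. g t)"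
    using lebesgue_integral_real_affine[of 1 "\<lambda>t. indicator {pi..<2 * pi} t *\<^sub>R g t" "2 * pi"]
    unfolding shift set_lebesgue_integral_def by simp
  have U: "{-pi..<pi} = {-pi..<0} \<union> {0..<pi}" "{0..<2 * pi} = {0..<pi} \<union> {pi..<2 * pi}"
    using pi_gt_zero by auto
  have ends: "set_integrable lebesgue {-pi..<pi} g = set_integrable lebesgue {-pi..pi} g"
    by (rule set_integrable_discrete_difference[of "{pi}"]) auto
  have ends_eq: "(LINT t:{-pi..<pi}|lebesgue. g t) = (LINT t:{-pi..pi}|lebesgue. g t)"
    by (rule set_integral_discrete_difference[of "{pi}"]) auto
  show "set_integrable lebesgue {-pi..pi} g"
    unfolding ends[symmetric] U by (rule set_integrable_Un[OF left sub(1)]) auto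
  have "(LINT t:{-pi..<pi}|lebesgue. g t) = (LINT t:{-pi..<0}|lebesgue. g t) + (LINT t:{0..<pi}|lebesgue. g t)"
    unfolding U by (rule set_integral_Un[OF _ left sub(1)]) auto
  moreover have "(LINT t:{0..<2 * pi}|lebesgue. g t) = (LINT t:{0..<pi}|lebesgue. g t) + (LINT t:{pi..<2 * pi}|lebesgue. g t)"
    unfolding U by (rule set_integral_Un[OF _ sub]) auto
  ultimately show "(LINT t:{-pi..pi}|lebesgue. g t) = (LINT t:{0..<2 * pi}|lebesgue. g t)"
    using left_eq ends_eq by simp
qed

lemma L1_per_set_integral:
  assumes "\<phi> \<in> L1_per"
  shows "set_integrable lebesgue {-pi..pi} \<phi>"
    and "(LINT t:{-pi..pi}|lebesgue. \<bar>\<phi> t\<bar>) = L1_norm \<phi>"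
proof -
  have per: "periodic_2pi \<phi>" and int: "set_integrable lebesgue {0..<2 * pi} \<phi>"
    using assms by (auto simp: L1_per_def)
  show "set_integrable lebesgue {-pi..pi} \<phi>"
    by (rule periodic_set_integral_shift[OF per int])
  have "periodic_2pi (\<lambda>t. \<bar>\<phi> t\<bar>)" using per by (simp add: periodic_2pi_def)
  then show "(LINT t:{-pi..pi}|lebesgue. \<bar>\<phi> t\<bar>) = L1_norm \<phi>"
    unfolding L1_norm_def by (rule periodic_set_integral_shift[OF _ set_integrable_abs[OF int]])
qed

lemma abs_set_integral_bounded_mult_le:
  fixes h \<phi> :: "real \<Rightarrow> real"
  assumes \<phi>: "set_integrable M S \<phi>" and h: "set_integrable M S (\<lambda>t. h t * \<phi> t)" and bound: "\<And>t. \<bar>h t\<bar> \<le> 1"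
  shows "\<bar>LINT t:S|M. h t * \<phi> t\<bar> \<le> (LINT t:S|M. \<bar>\<phi> t\<bar>)"
proof -
  have "\<bar>LINT t:S|M. h t * \<phi> t\<bar> \<le> (LINT t:S|M. \<bar>h t * \<phi> t\<bar>)"
    using integral_norm_bound[of M "\<lambda>t. indicator S t *\<^sub>R (h t * \<phi> t)"]
    by (simp add: set_lebesgue_integral_def abs_mult)
  also have "\<dots> \<le> (LINT t:S|M. \<bar>\<phi> t\<bar>)"
  proof (intro set_integral_mono set_integrable_abs \<phi> h)
    show "\<bar>h t * \<phi> t\<bar> \<le> \<bar>\<phi> t\<bar>" for t
      using mult_right_mono[OF bound[of t], of "\<bar>\<phi> t\<bar>"] by (simp add: abs_mult)
  qed
  finally show ?thesis .
qed

text \<open>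
  The kernel series converges absolutely, so \<open>f\<close> is itself an absolutely convergent
  trigonometric series whose \<open>k\<close>-th harmonic is \<open>\<psi>(k)\<close> times the \<open>k\<close>-th harmonic of \<open>\<phi>\<close>,
  rotated by the phase \<open>\<beta>\<pi>/2\<close>.  Subtracting a Fourier sum removes the first terms.
\<close>
lemma convolution_minus_fourier_sum:
  assumes c: "summable (\<lambda>j. \<bar>\<psi> (real (Suc j))\<bar>)" and \<phi>: "set_integrable lebesgue {-pi..pi} \<phi>"
    and f: "\<And>x. f x = a0 / 2 + 1 / pi * (LINT t:{-pi..pi}|lebesgue. kernel_Psi \<psi> \<beta> (x - t) * \<phi> t)"
  shows "(\<lambda>j. \<psi> (real (Suc (j + m))) *
            (LINT t:{-pi..pi}|lebesgue. cos (real (Suc (j + m)) * (x - t) - \<beta> * pi / 2) * \<phi> t))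
         sums (pi * (f x - fourier_sum m f x))"
proof -
  let ?I = "\<lambda>F. (LINT t:{-pi..pi}|lebesgue. F t * \<phi> t)"
  define \<theta> where "\<theta> = \<beta> * pi / 2"
  define P where "P = (\<lambda>k. ?I (\<lambda>t. cos (real k * t)))"
  define Q where "Q = (\<lambda>k. ?I (\<lambda>t. sin (real k * t)))"
  define L where "L = (LINT t:{-pi..pi}|lebesgue. \<bar>\<phi> t\<bar>)"
  have int: "set_integrable lebesgue {-pi..pi} (\<lambda>t. F t * \<phi> t)"
    if "continuous_on UNIV F" "\<And>t. \<bar>F t\<bar> \<le> 1" for F
    using that by (intro set_integrable_bounded_mult[OF \<phi>]) (auto intro: continuous_borel_measurable_lebesgue)
  have cosi: "set_integrable lebesgue {-pi..pi} (\<lambda>t. cos (real k * t) * \<phi> t)"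
   and sini: "set_integrable lebesgue {-pi..pi} (\<lambda>t. sin (real k * t) * \<phi> t)" for k
    by (intro int continuous_intros abs_cos_le_one abs_sin_le_one)+
  have PL: "\<bar>P k\<bar> \<le> L" and QL: "\<bar>Q k\<bar> \<le> L" for k
    unfolding P_def Q_def L_def
    by (intro abs_set_integral_bounded_mult_le \<phi> cosi sini abs_cos_le_one abs_sin_le_one)+
  have conv: "?I (\<lambda>t. cos (real k * (x - t) - \<theta>))
      = (P k * cos \<theta> - Q k * sin \<theta>) * cos (real k * x) + (P k * sin \<theta> + Q k * cos \<theta>) * sin (real k * x)" for k x
  proof -
    have "cos (real k * (x - t) - \<theta>) * \<phi> t = cos (real k * x - \<theta>) * (cos (real k * t) * \<phi> t) + sin (real k * x - \<theta>) * (sin (real k * t) * \<phi> t)" for t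
    proof -
      have "real k * (x - t) - \<theta> = (real k * x - \<theta>) - real k * t" by (simp add: algebra_simps)
      then show ?thesis by (simp only: cos_diff[of "real k * x - \<theta>"]) (simp only: distrib_right mult.assoc)
    qed
    then have "?I (\<lambda>t. cos (real k * (x - t) - \<theta>)) = cos (real k * x - \<theta>) * P k + sin (real k * x - \<theta>) * Q k"
      unfolding P_def Q_def
      by (simp add: set_integral_add(2)[OF set_integrable_mult_right[OF cosi] set_integrable_mult_right[OF sini]])
    then show ?thesis by (simp add: cos_diff sin_diff algebra_simps)
  qed
  define p where "p = (\<lambda>j. \<psi> (real (Suc j)) / pi * (P (Suc j) * cos \<theta> - Q (Suc j) * sin \<theta>))"
  define q where "q = (\<lambda>j. \<psi> (real (Suc j)) / pi * (P (Suc j) * sin \<theta> + Q (Suc j) * cos \<theta>))"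
  have bound: "\<bar>P k * y\<bar> + \<bar>Q k * z\<bar> \<le> 2 * L" if "\<bar>y\<bar> \<le> 1" "\<bar>z\<bar> \<le> 1" for k y z
    using mult_mono[OF PL[of k] that(1)] mult_mono[OF QL[of k] that(2)] order_trans[OF abs_ge_zero PL[of k]]
    by (simp add: abs_mult)
  have bp: "\<bar>p j\<bar> \<le> \<bar>\<psi> (real (Suc j))\<bar> * (2 * L / pi)" for j
  proof -
    have "\<bar>P (Suc j) * cos \<theta> - Q (Suc j) * sin \<theta>\<bar> \<le> 2 * L"
      using bound[of "cos \<theta>" "sin \<theta>" "Suc j"] abs_triangle_ineq4 order_trans by fastforce
    then show ?thesis
      using mult_left_mono[of _ "2 * L" "\<bar>\<psi> (real (Suc j))\<bar> / pi"] by (simp add: p_def abs_mult)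
  qed
  have bq: "\<bar>q j\<bar> \<le> \<bar>\<psi> (real (Suc j))\<bar> * (2 * L / pi)" for j
  proof -
    have "\<bar>P (Suc j) * sin \<theta> + Q (Suc j) * cos \<theta>\<bar> \<le> 2 * L"
      using bound[of "sin \<theta>" "cos \<theta>" "Suc j"] abs_triangle_ineq order_trans by fastforce
    then show ?thesis
      using mult_left_mono[of _ "2 * L" "\<bar>\<psi> (real (Suc j))\<bar> / pi"] by (simp add: q_def abs_mult)
  qed
  have sp: "summable (\<lambda>j. \<bar>p j\<bar>)"
    by (rule summable_comparison_test'[OF summable_mult2[OF c, of "2 * L / pi"], of 0]) (use bp in simp)
  have sq: "summable (\<lambda>j. \<bar>q j\<bar>)"
    by (rule summable_comparison_test'[OF summable_mult2[OF c, of "2 * L / pi"], of 0]) (use bq in simp)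
  have term_eq: "\<psi> (real (Suc j)) * ?I (\<lambda>t. cos (real (Suc j) * (x - t) - \<theta>))
      = pi * (p j * cos (real (Suc j) * x) + q j * sin (real (Suc j) * x))" for j x
    unfolding conv p_def q_def by (simp add: field_simps)
  have series: "f x = a0 / 2 + (\<Sum>j. p j * cos (real (Suc j) * x) + q j * sin (real (Suc j) * x))" for x
  proof -
    have "(\<lambda>j. \<psi> (real (Suc j)) * ?I (\<lambda>t. cos (real (Suc j) * (x - t) - \<theta>)))
        sums (LINT t:{-pi..pi}|lebesgue. kernel_Psi \<psi> \<beta> (x - t) * \<phi> t)"
      unfolding kernel_Psi_def \<theta>_def
      by (intro set_integral_suminf_bounded(2)[OF \<phi> c] continuous_borel_measurable_lebesgue continuous_intros abs_cos_le_one)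
    then have "(\<lambda>j. 1 / pi * (pi * (p j * cos (real (Suc j) * x) + q j * sin (real (Suc j) * x))))
        sums (1 / pi * (LINT t:{-pi..pi}|lebesgue. kernel_Psi \<psi> \<beta> (x - t) * \<phi> t))"
      unfolding term_eq by (rule sums_mult)
    then show ?thesis by (simp add: f sums_iff)
  qed
  from sums_mult[OF trig_series_minus_fourier_sum[OF sp sq series], of pi]
  show ?thesis unfolding term_eq[unfolded \<theta>_def] .
qed

lemma kernel_Psi_periodic: "kernel_Psi \<psi> \<beta> (t + 2 * pi) = kernel_Psi \<psi> \<beta> t"
proof -
  have "cos (y + 2 * real k * pi) = cos y" for y k
    by (simp only: cos_add sin_2npi cos_2npi)
  moreover have "real (Suc j) * (t + 2 * pi) - \<beta> * pi / 2 = (real (Suc j) * t - \<beta> * pi / 2) + 2 * real (Suc j) * pi" for j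
    by (simp add: algebra_simps)
  ultimately have "cos (real (Suc j) * (t + 2 * pi) - \<beta> * pi / 2) = cos (real (Suc j) * t - \<beta> * pi / 2)" for j
    by metis
  then show ?thesis by (simp add: kernel_Psi_def)
qed

section \<open>Dipoles\<close>

text \<open>
  The function \<open>\<phi>\<close> approximates half the difference of the point masses at \<open>0\<close> and \<open>r\<close>: the
  positive part has width \<open>h\<close> and lies just right of \<open>0\<close>, the negative part lies just left of
  \<open>r\<close>.  As both parts lie in \<open>(0, r)\<close> with \<open>r \<le> \<pi>\<close>, the periods \<open>[0, 2\<pi>)\<close> and \<open>[-\<pi>, \<pi>]\<close>, over
  which norm and mean are taken, see the same copy of the dipole.
\<close>
lemma dipole_exists:
  fixes r h :: real
  assumes h: "0 < h" "2 * h \<le> r" and r: "r \<le> pi"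
  obtains \<phi> where "\<phi> \<in> L1_per" "L1_norm \<phi> = 1" "(LINT t:{-pi..pi}|lebesgue. \<phi> t) = 0"
    and "\<And>F c. \<lbrakk>continuous_on UNIV F; \<And>t. \<bar>F t\<bar> \<le> 1; \<And>t. \<lbrakk>0 < t; t < h\<rbrakk> \<Longrightarrow> c \<le> F t;
        \<And>t. \<lbrakk>r - h < t; t < r\<rbrakk> \<Longrightarrow> F t \<le> - c\<rbrakk>
      \<Longrightarrow> c \<le> (LINT t:{-pi..pi}|lebesgue. F t * \<phi> t)"
proof -
  let ?A = "{0<..<h}" and ?B = "{r - h<..<r}"
  \<comment> \<open>Open intervals, so that \<open>g\<close> vanishes at \<open>r\<close>; for \<open>r = \<pi>\<close> this makes the periodic extension
      vanish at \<open>-\<pi>\<close> as well.\<close>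
  define g where "g = (\<lambda>t. (indicator ?A t - indicator ?B t) / (2 * h) :: real)"
  define \<phi> where "\<phi> = (\<lambda>t. g (t - 2 * pi * of_int \<lfloor>t / (2 * pi)\<rfloor>))"
  have g0: "g t = 0" if "t \<le> 0 \<or> r \<le> t" for t
    using that h by (auto simp: g_def indicator_def)
  have absg: "\<bar>g t\<bar> = (indicator ?A t + indicator ?B t) / (2 * h)" for t
    using h by (auto simp: g_def indicator_def)
  have int_ind: "integrable lebesgue (indicator ?A :: real \<Rightarrow> real)" "integrable lebesgue (indicator ?B :: real \<Rightarrow> real)"
    using h by (auto intro!: integrable_real_indicator simp: ennreal_less_top)
  have val: "(\<integral>t. indicator ?A t \<partial>lebesgue) = h" "(\<integral>t. indicator ?B t \<partial>lebesgue) = h"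
    using h by auto
  have gi: "integrable lebesgue g" unfolding g_def using int_ind by simp
  have g_mean: "integral\<^sup>L lebesgue g = 0" unfolding g_def using int_ind val by simp
  have g_norm: "(\<integral>t. \<bar>g t\<bar> \<partial>lebesgue) = 1" unfolding absg using int_ind val h by simp
  have \<phi>1: "\<phi> t = g t" if "0 \<le> t" "t < 2 * pi" for t
  proof -
    have "\<lfloor>t / (2 * pi)\<rfloor> = 0" using that by (simp add: floor_eq_iff)
    then show ?thesis by (simp add: \<phi>_def)
  qed
  have per: "\<phi> (t + 2 * pi) = \<phi> t" for t
  proof -
    have "\<lfloor>(t + 2 * pi) / (2 * pi)\<rfloor> = \<lfloor>t / (2 * pi)\<rfloor> + 1"
      by (simp add: add_divide_distrib)
    then show ?thesis by (simp add: \<phi>_def algebra_simps)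
  qed
  have \<phi>2: "\<phi> t = g t" if "t \<in> {-pi..pi}" for t
  proof (cases "0 \<le> t")
    case True
    moreover have "t < 2 * pi" using that pi_gt_zero unfolding atLeastAtMost_iff by linarith
    ultimately show ?thesis by (rule \<phi>1)
  next
    case False
    then have "\<phi> (t + 2 * pi) = g (t + 2 * pi)" using that by (intro \<phi>1) auto
    also have "\<dots> = g t" using False that r g0[of "t + 2 * pi"] g0[of t] by auto
    finally show ?thesis by (simp add: per)
  qed
  have r2: "r < 2 * pi" "t < - pi \<Longrightarrow> t \<le> 0" for t using r pi_gt_zero by linarith+
  have ind1: "indicator {0..<2 * pi} t *\<^sub>R \<phi> t = g t" for t
    using \<phi>1[of t] g0[of t] r2 by (auto simp: indicator_def)
  have ind1': "indicator {0..<2 * pi} t *\<^sub>R \<bar>\<phi> t\<bar> = \<bar>g t\<bar>" for t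
    using \<phi>1[of t] g0[of t] r2 by (auto simp: indicator_def)
  have ind2: "indicator {-pi..pi} t *\<^sub>R \<phi> t = g t" for t
    using \<phi>2[of t] g0[of t] r r2(2)[of t] by (auto simp: indicator_def not_le)
  have ind3: "indicator {-pi..pi} t *\<^sub>R (F t * \<phi> t) = F t * g t" for t and F :: "real \<Rightarrow> real"
    using \<phi>2[of t] g0[of t] r r2(2)[of t] by (auto simp: indicator_def not_le)
  have L1: "\<phi> \<in> L1_per"
  proof -
    have "set_integrable lebesgue {0..<2 * pi} \<phi>"
      unfolding set_integrable_def ind1 by (rule gi)
    then show ?thesis using per by (simp add: L1_per_def periodic_2pi_def)
  qed
  have norm: "L1_norm \<phi> = 1"
    unfolding L1_norm_def set_lebesgue_integral_def ind1' by (rule g_norm)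
  have mean: "(LINT t:{-pi..pi}|lebesgue. \<phi> t) = 0"
    unfolding set_lebesgue_integral_def ind2 by (rule g_mean)
  have "c \<le> (LINT t:{-pi..pi}|lebesgue. F t * \<phi> t)"
    if F: "continuous_on UNIV F" "\<And>t. \<bar>F t\<bar> \<le> 1"
      and A: "\<And>t. 0 < t \<Longrightarrow> t < h \<Longrightarrow> c \<le> F t" and B: "\<And>t. r - h < t \<Longrightarrow> t < r \<Longrightarrow> F t \<le> - c" for F c
  proof -
    have "set_integrable lebesgue {-pi..pi} (\<lambda>t. F t * \<phi> t)"
      using F L1_per_set_integral(1)[OF L1]
      by (intro set_integrable_bounded_mult) (auto intro: continuous_borel_measurable_lebesgue)
    then have Fg: "integrable lebesgue (\<lambda>t. F t * g t)"
      unfolding set_integrable_def ind3 .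
    have "c = (\<integral>t. c * \<bar>g t\<bar> \<partial>lebesgue)" by (simp add: g_norm)
    also have "\<dots> \<le> (\<integral>t. F t * g t \<partial>lebesgue)"
    proof (rule integral_mono[OF _ Fg])
      show "integrable lebesgue (\<lambda>t. c * \<bar>g t\<bar>)" using gi by simp
      show "c * \<bar>g t\<bar> \<le> F t * g t" for t
      proof -
        consider "t \<in> ?A" "t \<notin> ?B" | "t \<notin> ?A" "t \<in> ?B" | "t \<notin> ?A" "t \<notin> ?B"
          using h by fastforce
        then show ?thesis
        proof cases
          case 1
          then show ?thesis using A[of t] h by (simp add: g_def divide_right_mono)
        next
          case 2
          then have "c / (2 * h) \<le> - F t / (2 * h)"
            using B[of t] h by (intro divide_right_mono) auto
          then show ?thesis using 2 h by (simp add: g_def)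
        qed (simp add: g_def)
      qed
    qed
    finally show ?thesis unfolding set_lebesgue_integral_def ind3 .
  qed
  with L1 norm mean show thesis by (rule that)
qed

lemma cos_ge_one_minus_abs: "1 - \<bar>u\<bar> \<le> cos (u :: real)"
proof -
  have "(sin (u / 2))\<^sup>2 \<le> \<bar>sin (u / 2)\<bar>"
    using mult_left_mono[OF abs_sin_le_one[of "u / 2"], of "\<bar>sin (u / 2)\<bar>"]
    by (simp add: power2_eq_square flip: abs_mult)
  also have "\<dots> \<le> \<bar>u / 2\<bar>" by (rule abs_sin_x_le_abs_x)
  finally show ?thesis using cos_double_sin[of "u / 2"] by simp
qed

lemma phase_point:
  fixes \<theta> :: real and n :: nat
  assumes "n \<ge> 1"
  obtains x z where "0 \<le> x" "x < pi / real n" "real n * x - \<theta> = pi * of_int z"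
proof -
  define z where "z = \<lceil>- \<theta> / pi\<rceil>"
  define x where "x = (\<theta> + pi * of_int z) / real n"
  have "- \<theta> / pi \<le> of_int z" "of_int z < - \<theta> / pi + 1"
    unfolding z_def by linarith+
  then have "0 \<le> \<theta> + pi * of_int z" "\<theta> + pi * of_int z < pi"
    by (simp_all add: field_simps)
  then show thesis
    using assms by (intro that[of x z]) (auto simp: x_def divide_strict_right_mono)
qed

text \<open>
  The point \<open>x\<close> lies in \<open>[0, \<pi>/n)\<close> and makes the phase of the \<open>n\<close>-th harmonic a multiple of
  \<open>\<pi>\<close>.  At \<open>x\<close> that harmonic of the kernel, as a function of the shift \<open>t\<close>, equals the sign
  \<open>\<sigma>\<close> at \<open>t = 0\<close> and \<open>- \<sigma>\<close> at \<open>t = \<pi>/n\<close>, so it pairs with the dipole on these two points almost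
  optimally.  The harmonic of order \<open>n + j\<close> differs from it by a phase \<open>j (x - t)\<close>, and
  \<open>|x - t| \<le> \<pi>/n\<close>.  The two error terms are this drift and the width \<open>h\<close> of the dipole.
\<close>
lemma extremal_dipole:
  fixes n :: nat and h \<theta> :: real
  assumes n: "n \<ge> 1" and h: "0 < h" "real n * h \<le> 1"
  obtains \<phi> \<sigma> x where "\<phi> \<in> L1_per" "L1_norm \<phi> = 1" "(LINT t:{-pi..pi}|lebesgue. \<phi> t) = 0" "\<bar>\<sigma>\<bar> = (1::real)"
    "\<And>j. 1 - real j * (pi / real n) - real n * h
       \<le> \<sigma> * (LINT t:{-pi..pi}|lebesgue. cos (real (n + j) * (x - t) - \<theta>) * \<phi> t)"
proof -
  define r where "r = pi / real n"
  have nr: "real n * r = pi" using n by (simp add: r_def)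
  have "real n * (2 * h) \<le> real n * r" using h nr pi_gt3 by simp
  then have hr: "2 * h \<le> r" using n by simp
  have "r \<le> pi" using n by (simp add: r_def field_simps)
  from dipole_exists[OF h(1) hr this] obtain \<phi> where \<phi>: "\<phi> \<in> L1_per" "L1_norm \<phi> = 1" "(LINT t:{-pi..pi}|lebesgue. \<phi> t) = 0"
    and dip: "\<And>F c. continuous_on UNIV F \<Longrightarrow> (\<And>t. \<bar>F t\<bar> \<le> 1) \<Longrightarrow> (\<And>t. 0 < t \<Longrightarrow> t < h \<Longrightarrow> c \<le> F t)
      \<Longrightarrow> (\<And>t. r - h < t \<Longrightarrow> t < r \<Longrightarrow> F t \<le> - c) \<Longrightarrow> c \<le> (LINT t:{-pi..pi}|lebesgue. F t * \<phi> t)"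
    by blast
  obtain x z where x: "0 \<le> x" "x < r" and z: "real n * x - \<theta> = pi * of_int z"
    using phase_point[OF n] unfolding r_def by blast
  define \<sigma> where "\<sigma> = cos (pi * of_int z)"
  have sinz: "sin (pi * of_int z) = 0" by (simp add: sin_zero_iff_int2)
  have \<sigma>2: "\<sigma> * \<sigma> = 1" using sin_cos_squared_add3[of "pi * of_int z"] by (simp add: \<sigma>_def sinz)
  then have \<sigma>: "\<bar>\<sigma>\<bar> = 1" by (auto simp: square_eq_1_iff)
  have "1 - real j * r - real n * h
       \<le> \<sigma> * (LINT t:{-pi..pi}|lebesgue. cos (real (n + j) * (x - t) - \<theta>) * \<phi> t)" for j
  proof -
    let ?F = "\<lambda>t. \<sigma> * cos (real (n + j) * (x - t) - \<theta>)"
    have F: "?F t = cos (real j * (x - t) - real n * t)" for t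
    proof -
      have "real (n + j) * (x - t) - \<theta> = pi * of_int z + (real j * (x - t) - real n * t)"
        using z by (simp add: algebra_simps)
      then show ?thesis using \<sigma>2 by (simp only: cos_add sinz) (simp add: \<sigma>_def mult.assoc[symmetric])
    qed
    have small: "real j * \<bar>x - t\<bar> \<le> real j * r" if "0 < t" "t < r" for t
      using that x by (intro mult_left_mono) auto
    have "1 - real j * r - real n * h \<le> (LINT t:{-pi..pi}|lebesgue. ?F t * \<phi> t)"
    proof (rule dip)
      show "continuous_on UNIV ?F" by (intro continuous_intros)
      show "\<bar>?F t\<bar> \<le> 1" for t unfolding F by (rule abs_cos_le_one)
      fix t
      show "1 - real j * r - real n * h \<le> ?F t" if "0 < t" "t < h"
      proof -
        have "\<bar>real j * (x - t) - real n * t\<bar> \<le> real j * \<bar>x - t\<bar> + real n * \<bar>t\<bar>"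
          by (metis abs_mult abs_of_nat abs_triangle_ineq4)
        moreover have "real n * \<bar>t\<bar> \<le> real n * h" using that by (intro mult_left_mono) auto
        ultimately show ?thesis
          using small[of t] that hr h cos_ge_one_minus_abs[of "real j * (x - t) - real n * t"]
          unfolding F by linarith
      qed
      show "?F t \<le> - (1 - real j * r - real n * h)" if t: "r - h < t" "t < r"
      proof -
        have "real j * (x - t) - real n * t = (real j * (x - t) + real n * (r - t)) - pi"
          using nr by (simp add: algebra_simps)
        then have "?F t = - cos (real j * (x - t) + real n * (r - t))"
          by (simp only: F cos_minus_pi)
        moreover have "\<bar>real j * (x - t) + real n * (r - t)\<bar> \<le> real j * \<bar>x - t\<bar> + real n * \<bar>r - t\<bar>"
          by (metis abs_mult abs_of_nat abs_triangle_ineq)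
        moreover have "real n * \<bar>r - t\<bar> \<le> real n * h" using t by (intro mult_left_mono) auto
        ultimately show ?thesis
          using small[of t] t hr h cos_ge_one_minus_abs[of "real j * (x - t) + real n * (r - t)"]
          by linarith
      qed
    qed
    then show ?thesis by (simp add: mult.assoc)
  qed
  then show thesis using \<phi> \<sigma> by (intro that[of \<phi> \<sigma> x]) (auto simp: r_def)
qed

section \<open>The deviation in terms of coefficient sums\<close>

lemma fourier_deviation_le_coefficient_sum:
  assumes pos: "\<And>j. 0 \<le> \<psi> (real (Suc j))" and s: "summable (\<lambda>j. \<psi> (real (Suc j)))" and n: "n \<ge> 1"
  shows "fourier_deviation n (class_C \<psi> \<beta>) \<le> ereal ((\<Sum>j. \<psi> (real (n + j))) / pi)"
  unfolding fourier_deviation_def C_norm_def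
proof (intro SUP_least)
  fix f x assume "f \<in> class_C \<psi> \<beta>"
  then obtain a0 \<phi> where \<phi>: "\<phi> \<in> L1_per" "L1_norm \<phi> \<le> 1"
    and f: "\<And>x. f x = a0 / 2 + 1 / pi * (LINT t:{-pi..pi}|lebesgue. kernel_Psi \<psi> \<beta> (x - t) * \<phi> t)"
    by (auto simp: class_C_def)
  have s': "summable (\<lambda>j. \<bar>\<psi> (real (Suc j))\<bar>)" using s pos by simp
  note \<phi>i = L1_per_set_integral[OF \<phi>(1)]
  let ?I = "\<lambda>j. (LINT t:{-pi..pi}|lebesgue. cos (real (n + j) * (x - t) - \<beta> * pi / 2) * \<phi> t)"
  have idx: "Suc (j + (n - 1)) = n + j" for j using n by simp
  have sums: "(\<lambda>j. \<psi> (real (n + j)) * ?I j) sums (pi * (f x - fourier_sum (n - 1) f x))"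
    using convolution_minus_fourier_sum[OF s' \<phi>i(1) f, of "n - 1" x] unfolding idx .
  have pos': "0 \<le> \<psi> (real (n + j))" for j using pos[of "j + (n - 1)"] by (simp only: idx)
  have s2: "summable (\<lambda>j. \<psi> (real (n + j)))"
    using summable_ignore_initial_segment[OF s, of "n - 1"] by (simp only: idx)
  have "\<bar>?I j\<bar> \<le> 1" for j
  proof -
    have "set_integrable lebesgue {-pi..pi} (\<lambda>t. cos (real (n + j) * (x - t) - \<beta> * pi / 2) * \<phi> t)"
      by (intro set_integrable_bounded_mult \<phi>i(1) continuous_borel_measurable_lebesgue continuous_intros abs_cos_le_one)
    from abs_set_integral_bounded_mult_le[OF \<phi>i(1) this abs_cos_le_one] \<phi>i(2) \<phi>(2)
    show ?thesis by simp
  qed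
  then have le: "norm (\<psi> (real (n + j)) * ?I j) \<le> \<psi> (real (n + j))" for j
    using mult_left_mono[of "\<bar>?I j\<bar>" 1 "\<psi> (real (n + j))"] pos'[of j] by (simp add: abs_mult)
  have "\<bar>pi * (f x - fourier_sum (n - 1) f x)\<bar> \<le> (\<Sum>j. \<psi> (real (n + j)))"
    using norm_suminf_le[OF le s2] sums by (simp add: sums_iff)
  then show "ereal \<bar>f x - fourier_sum (n - 1) f x\<bar> \<le> ereal ((\<Sum>j. \<psi> (real (n + j))) / pi)"
    by (simp add: abs_mult pos_le_divide_eq mult.commute del: right_diff_distrib right_diff_distrib')
qed

text \<open>
  Inserting the dipole into the remainder series gives \<open>(1 - n h) S - (\<pi>/n) T\<close>.  No limit
  \<open>h \<rightarrow> 0\<close> is needed: the theorem tolerates a loss of \<open>\<psi>(n)\<close>, so a dipole of the fixed width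
  \<open>\<psi>(n) / (n S)\<close> is narrow enough.
\<close>
lemma fourier_deviation_ge_coefficient_sum:
  assumes pos: "\<And>j. 0 < \<psi> (real (Suc j))" and s: "summable (\<lambda>j. \<psi> (real (Suc j)))" and n: "n \<ge> 1"
    and sT: "summable (\<lambda>j. real j * \<psi> (real (n + j)))"
  defines "S \<equiv> \<Sum>j. \<psi> (real (n + j))" and "T \<equiv> \<Sum>j. real j * \<psi> (real (n + j))"
  shows "ereal ((S - \<psi> (real n) - pi / real n * T) / pi) \<le> fourier_deviation n (class_C \<psi> \<beta>)"
    and "0 \<le> fourier_deviation n (class_C \<psi> \<beta>)"
proof -
  have idx: "Suc (j + (n - 1)) = n + j" for j using n by simp
  have pos': "0 < \<psi> (real (n + j))" for j using pos[of "j + (n - 1)"] by (simp only: idx)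
  have s2: "summable (\<lambda>j. \<psi> (real (n + j)))"
    using summable_ignore_initial_segment[OF s, of "n - 1"] by (simp only: idx)
  have s': "summable (\<lambda>j. \<bar>\<psi> (real (Suc j))\<bar>)"
    using s pos by (simp add: less_imp_le)
  have \<psi>S: "\<psi> (real n) \<le> S"
    using sum_le_suminf[OF s2, of "{0}"] pos' by (simp add: S_def less_imp_le)
  have \<psi>n: "0 < \<psi> (real n)" using pos'[of 0] by simp
  define h where "h = \<psi> (real n) / (real n * S)"
  have S: "0 < S" using \<psi>S \<psi>n by simp
  then have nh: "real n * h = \<psi> (real n) / S" using n by (simp add: h_def)
  have hS: "real n * h * S = \<psi> (real n)" and h: "0 < h" "real n * h \<le> 1"
    unfolding nh using n \<psi>S \<psi>n S by (simp_all add: h_def)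
  obtain \<phi> \<sigma> x where \<phi>: "\<phi> \<in> L1_per" "L1_norm \<phi> = 1" "(LINT t:{-pi..pi}|lebesgue. \<phi> t) = 0" and \<sigma>: "\<bar>\<sigma>\<bar> = (1::real)"
    and I: "\<And>j. 1 - real j * (pi / real n) - real n * h
       \<le> \<sigma> * (LINT t:{-pi..pi}|lebesgue. cos (real (n + j) * (x - t) - \<beta> * pi / 2) * \<phi> t)"
    by (rule extremal_dipole[OF n h, of "\<beta> * pi / 2"]) blast
  define f where "f = (\<lambda>x. 0 / 2 + 1 / pi * (LINT t:{-pi..pi}|lebesgue. kernel_Psi \<psi> \<beta> (x - t) * \<phi> t))"
  have "kernel_Psi \<psi> \<beta> (y + 2 * pi - t) = kernel_Psi \<psi> \<beta> (y - t)" for y t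
    using kernel_Psi_periodic[of \<psi> \<beta> "y - t"] by (simp only: diff_add_eq)
  then have "periodic_2pi f" unfolding f_def periodic_2pi_def by presburger
  moreover have "\<forall>x. f x = 0 / 2 + 1 / pi * (LINT t:{-pi..pi}|lebesgue. kernel_Psi \<psi> \<beta> (x - t) * \<phi> t)"
    by (simp add: f_def)
  ultimately have f: "f \<in> class_C \<psi> \<beta>"
    unfolding class_C_def using \<phi> eq_refl[OF \<phi>(2)] by blast
  let ?d = "f x - fourier_sum (n - 1) f x"
  let ?I = "\<lambda>j. (LINT t:{-pi..pi}|lebesgue. cos (real (n + j) * (x - t) - \<beta> * pi / 2) * \<phi> t)"
  have "(\<lambda>j. \<psi> (real (n + j)) * ?I j) sums (pi * ?d)"
    using convolution_minus_fourier_sum[OF s' L1_per_set_integral(1)[OF \<phi>(1)], of f 0 \<beta> "n - 1" x]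
    unfolding idx f_def by simp
  then have sums: "(\<lambda>j. \<sigma> * (\<psi> (real (n + j)) * ?I j)) sums (\<sigma> * (pi * ?d))"
    by (rule sums_mult)
  have minorant: "(\<lambda>j. (1 - real n * h) * \<psi> (real (n + j)) - pi / real n * (real j * \<psi> (real (n + j))))
      sums ((1 - real n * h) * S - pi / real n * T)"
    unfolding S_def T_def by (intro sums_diff sums_mult summable_sums s2 sT)
  have termwise: "(1 - real n * h) * \<psi> (real (n + j)) - pi / real n * (real j * \<psi> (real (n + j))) \<le> \<sigma> * (\<psi> (real (n + j)) * ?I j)" for j
    using mult_left_mono[OF I[of j], of "\<psi> (real (n + j))"] pos'[of j] by (simp add: algebra_simps)
  have "(1 - real n * h) * S - pi / real n * T \<le> \<sigma> * (pi * ?d)"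
    by (rule sums_le[OF termwise minorant sums])
  also have "\<dots> \<le> \<bar>?d\<bar> * pi"
    using \<sigma> abs_ge_self[of "\<sigma> * (pi * ?d)"] by (simp add: abs_mult)
  finally have "(S - \<psi> (real n) - pi / real n * T) / pi \<le> \<bar>?d\<bar>"
    using hS by (simp add: pos_divide_le_eq algebra_simps)
  then have "ereal ((S - \<psi> (real n) - pi / real n * T) / pi) \<le> ereal \<bar>?d\<bar>" by simp
  also have dev: "ereal \<bar>?d\<bar> \<le> fourier_deviation n (class_C \<psi> \<beta>)"
    unfolding fourier_deviation_def C_norm_def using f by (intro SUP_upper2[of f] SUP_upper2[of x]) auto
  finally show "ereal ((S - \<psi> (real n) - pi / real n * T) / pi) \<le> fourier_deviation n (class_C \<psi> \<beta>)" .
  show "0 \<le> fourier_deviation n (class_C \<psi> \<beta>)"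
    by (rule order_trans[OF _ dev]) simp
qed

section \<open>The asymptotic formula\<close>

lemma real_between_convex_combination:
  fixes e :: real
  assumes "A \<le> e" "e \<le> B" "A \<le> B"
  obtains s where "0 \<le> s" "s \<le> 1" "e = (1 - s) * A + s * B"
proof (cases "A = B")
  case True
  then show thesis using assms by (intro that[of 0]) auto
next
  case False
  define s where "s = (e - A) / (B - A)"
  have "s * (B - A) = e - A" "0 \<le> s" "s \<le> 1"
    using False assms by (auto simp: s_def divide_le_eq)
  then show thesis by (intro that[of s]) (auto simp: algebra_simps)
qed

text \<open>
  A form affine in two parameters takes every value between those at two opposite corners of a
  rectangle, so an estimate from both sides yields admissible \<open>\<xi>\<^sub>1\<close> and \<open>\<xi>\<^sub>2\<close>.
\<close>
lemma ereal_affine_form: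
  fixes E :: ereal and u l a p1 p2 q1 q2 c :: real
  assumes "ereal (u * l * (c + p1 / l + p2 * a)) \<le> E" "E \<le> ereal (u * l * (c + q1 / l + q2 * a))"
    and "p1 \<le> q1" "p2 \<le> q2" "0 \<le> u" "0 \<le> l" "0 \<le> a"
  shows "\<exists>x1 x2. p1 \<le> x1 \<and> x1 \<le> q1 \<and> p2 \<le> x2 \<and> x2 \<le> q2 \<and> E = ereal (u * l * (c + x1 / l + x2 * a))"
proof -
  let ?G = "\<lambda>x y. u * l * (c + x / l + y * a)"
  obtain e where e: "E = ereal e" using assms(1,2) by (cases E) auto
  have le: "?G p1 p2 \<le> ?G q1 q2"
    using assms by (intro mult_left_mono add_mono divide_right_mono mult_right_mono) auto
  obtain s where s: "0 \<le> s" "s \<le> 1" "e = (1 - s) * ?G p1 p2 + s * ?G q1 q2"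
    by (rule real_between_convex_combination[of "?G p1 p2" e "?G q1 q2"]) (use assms(1,2) le in \<open>simp_all add: e\<close>)
  have conv: "x \<le> (1 - s) * x + s * y \<and> (1 - s) * x + s * y \<le> y" if "x \<le> y" for x y
  proof -
    have "s * (y - x) \<le> 1 * (y - x)" "0 \<le> s * (y - x)" using s that by (intro mult_right_mono, auto)
    then show ?thesis by (simp add: algebra_simps)
  qed
  have "e = ?G ((1 - s) * p1 + s * q1) ((1 - s) * p2 + s * q2)"
    unfolding s(3) by (simp add: algebra_simps add_divide_distrib diff_divide_distrib)
  with conv[OF assms(3)] conv[OF assms(4)] show ?thesis
    unfolding e by blast
qed

theorem mainTheorem3:
  fixes \<beta> :: real and \<psi> :: "real \<Rightarrow> real"
  assumes "\<psi> \<in> class_M"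
    and "decreases_to_0 (char_alpha \<psi>)"
    and "increases_to_infinity (char_lambda \<psi>)"
  shows "\<forall>n::nat. n \<ge> 1 \<and> char_alpha \<psi> (real n) \<le> 1 / 4 \<longrightarrow>
    (\<exists>\<xi>1 \<xi>2 :: real. -1 \<le> \<xi>1 \<and> \<xi>1 \<le> 1 + 1 / pi \<and> -4 \<le> \<xi>2 \<and> \<xi>2 \<le> 4 / 3 * (1 + 1 / pi) \<and>
      fourier_deviation n (class_C \<psi> \<beta>) =
        ereal (\<psi> (real n) * char_lambda \<psi> (real n) *
          (1 / pi + \<xi>1 / char_lambda \<psi> (real n) + \<xi>2 * char_alpha \<psi> (real n))))"
proof (intro allI impI, elim conjE)
  fix n :: nat assume n: "n \<ge> 1" and a4: "char_alpha \<psi> (real n) \<le> 1 / 4"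
  define a where "a = char_alpha \<psi> (real n)"
  define l where "l = char_lambda \<psi> (real n)"
  define u where "u = (\<lambda>j. \<psi> (real (n + j)))"
  define S where "S = suminf u"
  define T where "T = (\<Sum>j. real j * u j)"
  let ?E = "fourier_deviation n (class_C \<psi> \<beta>)"
  have mono: "antimono_on {1..} (char_alpha \<psi>)" "mono_on {1..} (char_lambda \<psi>)"
    using assms(2,3) by (simp_all add: decreases_to_0_def increases_to_infinity_def)
  note decay = class_M_decay_at_integers[OF assms(1) mono n, folded a_def l_def]
  have a: "0 < a" "a \<le> 1/4" using decay(1) a4 by (simp_all add: a_def)
  have la: "l = real n * a" using decay(2) .
  have l: "0 < l" using la a n by simp
  have pos: "0 < \<psi> (real k)" if "k \<ge> 1" for k using assms(1) that by (simp add: class_M_def)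
  have pos_Suc: "0 < \<psi> (real (Suc j))" for j by (rule pos) simp
  have u_pos: "0 < u j" for j unfolding u_def by (rule pos) (use n in simp)
  have dec: "u (Suc j) \<le> a * (real n + real j + 1) * (u j - u (Suc j))" for j
    unfolding u_def by (rule decay(3))
  have "0 \<le> a" using a by simp
  note mom = summable_moments_of_fast_decay[of u a "real n", OF less_imp_le[OF u_pos] \<open>0 \<le> a\<close> a(2) of_nat_0_le_iff dec]
  have S_lower: "l * u 0 \<le> S"
    unfolding S_def using decay(4) by (intro suminf_ge_of_slow_decay mom(1)) (simp only: u_def)
  have S_upper: "S \<le> u 0 * (l + 4 / 3 * l * a + 4 / 3)"
  proof -
    have "1 / (1 - a) \<le> 1 + 4 / 3 * a" "a / (1 - a) \<le> 1 / 3"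
      using a mult_left_mono[of "4 * a" 1 a] by (simp_all add: field_simps)
    then have "l * (1 / (1 - a)) + a / (1 - a) \<le> l * (1 + 4 / 3 * a) + 1 / 3"
      using l by (intro add_mono mult_left_mono) auto
    then have "(a * real n + a) / (1 - a) \<le> l + 4 / 3 * l * a + 1 / 3"
      unfolding la by (simp add: add_divide_distrib algebra_simps)
    with mult_right_mono[OF this less_imp_le[OF u_pos[of 0]]] mom(2)
    show ?thesis unfolding S_def by (simp add: algebra_simps)
  qed
  have T_upper: "pi / real n * T \<le> 4 * pi * a * S"
  proof -
    have "0 \<le> S" using S_lower l u_pos[of 0] by (smt (verit) mult_pos_pos)
    have "T \<le> 2 * a * (real n + 1) * S" unfolding T_def S_def by (rule mom(4))
    also have "\<dots> \<le> 2 * a * (2 * real n) * S"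
      using n a \<open>0 \<le> S\<close> by (intro mult_right_mono mult_left_mono) auto
    finally have "pi / real n * T \<le> pi / real n * (2 * a * (2 * real n) * S)"
      by (intro mult_left_mono) auto
    then show ?thesis using n by (simp add: mult_ac)
  qed
  have s: "summable (\<lambda>j. \<psi> (real (Suc j)))"
  proof -
    have "summable (\<lambda>j. \<psi> (real (j + n)))" using mom(1) by (simp add: u_def add.commute)
    then have "summable (\<lambda>j. \<psi> (real j))" by (rule summable_iff_shift[THEN iffD1])
    then show ?thesis by (rule summable_Suc_iff[THEN iffD2])
  qed
  have upper: "?E \<le> ereal (S / pi)"
    using fourier_deviation_le_coefficient_sum[OF less_imp_le[OF pos_Suc] s n] unfolding S_def u_def .
  have lower: "ereal ((S - u 0 - pi / real n * T) / pi) \<le> ?E" "0 \<le> ?E"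
    using fourier_deviation_ge_coefficient_sum[OF pos_Suc s n mom(3)[unfolded u_def]] unfolding S_def T_def u_def by simp_all
  have pi: "1 / pi \<le> 1" "4 / (3 * pi) \<le> 1" using pi_gt3 by (simp_all add: field_simps)
  have form: "u 0 * l * (1 / pi + x / l + y * a) = u 0 * (l / pi + x + y * l * a)" for x y
    using l by (simp add: field_simps)
  have "S / pi \<le> u 0 * l * (1 / pi + (1 + 1 / pi) / l + 4 / 3 * (1 + 1 / pi) * a)"
  proof -
    have "S / pi \<le> u 0 * ((l + 4 / 3 * l * a + 4 / 3) / pi)"
      using divide_right_mono[OF S_upper, of pi] by simp
    also have "(l + 4 / 3 * l * a + 4 / 3) / pi = l / pi + 4 / (3 * pi) + 4 / 3 * (1 / pi) * l * a"
      by (simp add: field_simps)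
    also have "u 0 * \<dots> \<le> u 0 * (l / pi + (1 + 1 / pi) + 4 / 3 * (1 + 1 / pi) * l * a)"
      using pi l a u_pos[of 0] by (intro mult_left_mono add_mono mult_right_mono) (auto intro: add_increasing2)
    finally show ?thesis unfolding form .
  qed
  with upper have U: "?E \<le> ereal (u 0 * l * (1 / pi + (1 + 1 / pi) / l + 4 / 3 * (1 + 1 / pi) * a))"
    by (meson ereal_less_eq(3) order_trans)
  \<comment> \<open>If \<open>4 \<pi> a > 1\<close>, the lower bound for \<open>S\<close> cannot be multiplied by \<open>1 - 4 \<pi> a\<close>, but then the
      claimed bound is negative.\<close>
  have L: "ereal (u 0 * l * (1 / pi + - 1 / l + - 4 * a)) \<le> ?E"
  proof (cases "4 * pi * a \<le> 1")
    case True
    have "u 0 * (l / pi + - 1 + - 4 * l * a) = (1 - 4 * pi * a) * (l * u 0) / pi - u 0"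
      by (simp add: field_simps)
    also have "\<dots> \<le> (1 - 4 * pi * a) * S / pi - u 0 / pi"
      using True S_lower pi(1) u_pos[of 0]
      by (intro diff_mono divide_right_mono mult_left_mono) (auto simp: divide_le_eq mult_le_cancel_left1)
    also have "\<dots> \<le> (S - u 0 - pi / real n * T) / pi"
      using divide_right_mono[OF T_upper, of pi] by (simp add: diff_divide_distrib left_diff_distrib)
    finally show ?thesis unfolding form using lower(1) by (meson ereal_less_eq(3) order_trans)
  next
    case False
    then have "l * 1 \<le> l * (4 * pi * a)" using l by (intro mult_left_mono) auto
    then have "l / pi \<le> 4 * l * a" by (simp add: field_simps)
    then have "l / pi + - 1 + - 4 * l * a \<le> 0" by simp
    then have "u 0 * (l / pi + - 1 + - 4 * l * a) \<le> 0"
      using u_pos[of 0] by (simp add: mult_le_0_iff)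
    then show ?thesis unfolding form using lower(2) by (meson ereal_less_eq(4) order_trans)
  qed
  have "\<exists>\<xi>1 \<xi>2. - 1 \<le> \<xi>1 \<and> \<xi>1 \<le> 1 + 1 / pi \<and> - 4 \<le> \<xi>2 \<and> \<xi>2 \<le> 4 / 3 * (1 + 1 / pi) \<and>
      ?E = ereal (u 0 * l * (1 / pi + \<xi>1 / l + \<xi>2 * a))"
    using l a u_pos[of 0] by (intro ereal_affine_form[OF L U]) (auto intro: order_trans[of _ 0])
  then show "\<exists>\<xi>1 \<xi>2. - 1 \<le> \<xi>1 \<and> \<xi>1 \<le> 1 + 1 / pi \<and> - 4 \<le> \<xi>2 \<and> \<xi>2 \<le> 4 / 3 * (1 + 1 / pi) \<and>
      ?E = ereal (\<psi> (real n) * char_lambda \<psi> (real n) * (1 / pi + \<xi>1 / char_lambda \<psi> (real n) + \<xi>2 * char_alpha \<psi> (real n)))"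
    by (simp add: u_def a_def l_def)
qed

end
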